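(* Let $n\ge1$ be an integer. For positive integers $a$, $b$, and $c$, we have \[ \operatorname{vol}\mathcal F_{\mathrm{PS}_{n+2}}(a,b,c^{n-1})=(a+b-c)\bigl(a+b+(n-1)c\bigr)^{n-1}-(b-c)\bigl(b+(n-1)c\bigr)^{n-1}. \]
   Context: Flow polytope: let $G$ be a connected directed graph on $\{1,\dots,N+1\}$ with $M$ edges, each of the form $(i,j)$ with $i<j$, with edge set $E$, and let $\mathbf a=(a_1,\dots,a_N)\in\mathbb Z^N$. The flow polytope $\mathcal F_G(\mathbf a)$ is the set of all $(b_e)_{e\in E}\in\mathbb R_{\ge0}^M$ such that $\sum_{e=(i,j)\in E} b_e(\mathbf e_i-\mathbf e_j)=(a_1,\dots,a_N,-\sum_{i=1}^N a_i)$, where $\mathbf e_i$ is the $i$th standard basis vector of $\mathbb R^{N+1}$. Its normalized volume $\operatorname{vol}\mathcal F_G(\mathbf a)$ is $(M-N)!$ times its $(M-N)$-dimensional volume in the affine space cut out by these equations, scaled so that a fundamental parallelepiped of the lattice $\{b\in\mathbb Z^M:\sum b_e(\mathbf e_i-\mathbf e_j)=0\}$ has volume $1$. The Pitman–Stanley graph $\mathrm{PS}_{n+2}$ has vertex set $\{1,\dots,n+2\}$ and edge set $\{(i,i+1):1\le i\le n+1\}\cup\{(i,n+2):1\le i\le n\}$. In a net flow vector, $c^{j}$ denotes the sequence $c,\dots,c$ of $j$ copies of $c$; thus $(a,b,c^{n-1})$ has $n+1$ entries. *)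

theory Defs
  imports "HOL-Analysis.Analysis" "Graph_Theory.Digraph_Component"
begin

locale flow_graph = fin_digraph G for G :: "(nat, 'e) pre_digraph" and N :: nat +
  assumes verts_eq: "verts G = {1..N + 1}"
    and tail_less_head: "e \<in> arcs G \<Longrightarrow> tail G e < head G e"
    and connected_graph: "Digraph_Component.connected G"

text \<open>
  The \<open>v\<close>-th coordinate of \<open>\<Sum>b\<^sub>e (e\<^sub>i - e\<^sub>j)\<close>, summed over the arcs \<open>e = (i, j)\<close>.
\<close>
definition net_flow :: "(nat, 'e) pre_digraph \<Rightarrow> ('e \<Rightarrow> 'r::comm_ring_1) \<Rightarrow> nat \<Rightarrow> 'r" where
  "net_flow G b v = (\<Sum>e\<in>arcs G. b e * (of_bool (v = tail G e) - of_bool (v = head G e)))"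

text \<open>
  Elements of \<open>\<real>\<^sup>E\<close> and \<open>\<int>\<^sup>E\<close> are represented by functions that vanish outside the arc set \<open>E\<close>.
  A net flow vector \<open>(a\<^sub>1, \<dots>, a\<^sub>N)\<close> is a list of length \<open>N\<close>, so that \<open>a\<^sub>v\<close> is \<open>a ! (v - 1)\<close>;
  the vertices are \<open>1, \<dots>, N + 1\<close>.
\<close>
definition flow_space :: "(nat, 'e) pre_digraph \<Rightarrow> int list \<Rightarrow> ('e \<Rightarrow> real) set" where
  "flow_space G a = {b. (\<forall>e. e \<notin> arcs G \<longrightarrow> b e = 0) \<and>
     (\<forall>v\<in>verts G. net_flow G b v =
        of_int (if v \<le> length a then a ! (v - 1) else - sum_list a))}"

definition flow_polytope :: "(nat, 'e) pre_digraph \<Rightarrow> int list \<Rightarrow> ('e \<Rightarrow> real) set" where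
  "flow_polytope G a = {b \<in> flow_space G a. \<forall>e\<in>arcs G. 0 \<le> b e}"

definition flow_lattice :: "(nat, 'e) pre_digraph \<Rightarrow> ('e \<Rightarrow> int) set" where
  "flow_lattice G = {x. (\<forall>e. e \<notin> arcs G \<longrightarrow> x e = 0) \<and> (\<forall>v\<in>verts G. net_flow G x v = 0)}"

definition lattice_basis :: "nat \<Rightarrow> (nat \<Rightarrow> 'e \<Rightarrow> int) \<Rightarrow> ('e \<Rightarrow> int) set \<Rightarrow> bool" where
  "lattice_basis d u L \<longleftrightarrow>
     bij_betw (\<lambda>k e. \<Sum>i<d. k i * u i e) ({..<d} \<rightarrow>\<^sub>E UNIV) L"

text \<open>
  The \<open>d\<close>-dimensional volume of a subset \<open>S\<close> of an affine space \<open>A\<close> with directing lattice \<open>L\<close>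
  of rank \<open>d\<close>, scaled so that a fundamental parallelepiped of \<open>L\<close> has volume 1: Lebesgue measure
  in the affine coordinates given by a point \<open>p\<close> of \<open>A\<close> and a basis \<open>u\<close> of \<open>L\<close>, in which
  the parallelepiped spanned by \<open>u\<close> is the unit cube.  Another choice of \<open>p\<close> and \<open>u\<close> changes
  the coordinates by a translation and an element of \<open>GL\<^sub>d(\<int>)\<close>, which preserves the measure.
\<close>
definition coordinate_volume ::
  "nat \<Rightarrow> ('e \<Rightarrow> real) \<Rightarrow> (nat \<Rightarrow> 'e \<Rightarrow> int) \<Rightarrow> ('e \<Rightarrow> real) set \<Rightarrow> real" where
  "coordinate_volume d p u S =
     measure (\<Pi>\<^sub>M i\<in>{..<d}. (lborel :: real measure))
       {t \<in> {..<d} \<rightarrow>\<^sub>E UNIV. (\<lambda>e. p e + (\<Sum>i<d. t i * of_int (u i e))) \<in> S}"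

definition lattice_volume ::
  "nat \<Rightarrow> ('e \<Rightarrow> int) set \<Rightarrow> ('e \<Rightarrow> real) set \<Rightarrow> ('e \<Rightarrow> real) set \<Rightarrow> real" where
  "lattice_volume d L A S =
     coordinate_volume d (SOME p. p \<in> A) (SOME u. lattice_basis d u L) S"

definition normalized_volume :: "(nat, 'e) pre_digraph \<Rightarrow> int list \<Rightarrow> real" where
  "normalized_volume G a =
     (let d = card (arcs G) - length a
      in fact d * lattice_volume d (flow_lattice G) (flow_space G a) (flow_polytope G a))"

text \<open>\<open>pitman_stanley m\<close> is the graph \<open>PS\<^sub>m\<close> on \<open>m\<close> vertices, so \<open>m = n + 2\<close>.\<close>
definition pitman_stanley :: "nat \<Rightarrow> (nat, nat \<times> nat) pre_digraph" where
  "pitman_stanley m =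
     \<lparr>verts = {1..m},
      arcs = {(i, i + 1) | i. 1 \<le> i \<and> i \<le> m - 1} \<union> {(i, m) | i. 1 \<le> i \<and> i \<le> m - 2},
      tail = fst, head = snd\<rparr>"

lemma flow_graph_pitman_stanley: "flow_graph (pitman_stanley (n + 2)) (n + 1)"
proof -
  define G where "G = pitman_stanley (n + 2)"
  have arcs: "arcs G = (\<lambda>i. (i, i + 1)) ` {1..n + 1} \<union> (\<lambda>i. (i, n + 2)) ` {1..n}"
    by (auto simp: G_def pitman_stanley_def)
  have verts: "verts G = {1..n + 2}"
    by (simp add: G_def pitman_stanley_def)
  have th: "tail G = fst" "head G = snd"
    by (simp_all add: G_def pitman_stanley_def)
  let ?R = "rtrancl_on (verts G) ((arcs_ends G)\<^sup>s)"
  have to_1: "Suc i \<le> n + 2 \<Longrightarrow> (1, Suc i) \<in> ?R \<and> (Suc i, 1) \<in> ?R" for i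
  proof (induction i)
    case 0
    then show ?case
      using verts by (auto intro: rtrancl_on_refl)
  next
    case (Suc i)
    have "(Suc i, Suc (Suc i)) \<in> arcs_ends G"
      using Suc.prems by (auto simp: arcs_ends_conv th arcs image_iff)
    then have "(Suc i, Suc (Suc i)) \<in> (arcs_ends G)\<^sup>s" "(Suc (Suc i), Suc i) \<in> (arcs_ends G)\<^sup>s"
      by (auto simp: symcl_def)
    moreover have "Suc i \<in> verts G" "Suc (Suc i) \<in> verts G"
      using Suc.prems verts by auto
    ultimately have "(Suc i, Suc (Suc i)) \<in> ?R" "(Suc (Suc i), Suc i) \<in> ?R"
      by (auto intro: rtrancl_on_into_rtrancl_on rtrancl_on_refl)
    then show ?case
      using Suc by (auto intro: rtrancl_on_trans)
  qed
  have "(u, v) \<in> ?R" if "u \<in> verts G" "v \<in> verts G" for u v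
  proof -
    have "Suc (u - 1) = u" "u \<le> n + 2" "Suc (v - 1) = v" "v \<le> n + 2"
      using that verts by auto
    then have "(u, 1) \<in> ?R" "(1, v) \<in> ?R"
      using to_1[of "u - 1"] to_1[of "v - 1"] by metis+
    then show ?thesis
      by (rule rtrancl_on_trans)
  qed
  then have "Digraph_Component.connected G"
    using verts by (simp add: connected_conv)
  then have "flow_graph G (n + 1)"
    by unfold_locales (auto simp: verts th arcs)
  then show ?thesis
    by (simp add: G_def)
qed

lemma card_arcs_pitman_stanley: "card (arcs (pitman_stanley (n + 2))) = 2 * n + 1"
proof -
  have arcs: "arcs (pitman_stanley (n + 2)) =
      (\<lambda>i. (i, i + 1)) ` {1..n + 1} \<union> (\<lambda>i. (i, n + 2)) ` {1..n}"
    by (auto simp: pitman_stanley_def)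
  have "(\<lambda>i. (i, i + 1)) ` {1..n + 1} \<inter> (\<lambda>i. (i, n + 2)) ` {1..n} = {}"
    by auto
  then show ?thesis
    unfolding arcs by (subst card_Un_disjoint) (auto simp: card_image inj_on_def)
qed

end

theory Submission
  imports Defs
begin

text \<open>
  A flow on \<open>PS\<^sub>n\<^sub>+\<^sub>2\<close> is determined by its values \<open>y\<^sub>1, \<dots>, y\<^sub>n\<close> on the edges \<open>(i, n + 2)\<close>: the cut
  \<open>{1..j}\<close> gives the value \<open>a\<^sub>1 + \<dots> + a\<^sub>j - (y\<^sub>1 + \<dots> + y\<^sub>j)\<close> on \<open>(j, j + 1)\<close>, and nonnegativity on
  \<open>(n + 1, n + 2)\<close> follows from that on \<open>(n, n + 1)\<close>.  The flow polytope is thus the Pitman--Stanley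
  region \<open>y \<ge> 0\<close>, \<open>y\<^sub>1 + \<dots> + y\<^sub>j \<le> a\<^sub>1 + \<dots> + a\<^sub>j\<close>.  Integrating out \<open>y\<^sub>1\<close> leaves a region of the
  same kind in one dimension less; with \<open>q\<^sub>m(s) = s (s + m c)\<^sup>m\<^sup>-\<^sup>1 / m!\<close> one has
  \<open>q\<^sub>m\<^sub>+\<^sub>1'(s) = q\<^sub>m(s + c)\<close>, so that \<open>q\<^sub>m(s)\<close> is the volume for bounds \<open>(s, c, \<dots>, c)\<close>, and that for
  \<open>(a, b, c, \<dots>, c)\<close> is \<open>q\<^sub>n(a + b - c) - q\<^sub>n(b - c)\<close>.

  The volume does not depend on the basis of the lattice because an automorphism \<open>T\<close> of
  \<open>\<int>\<^sup>n\<close> preserves Lebesgue measure: the image is again translation invariant, and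
  \<open>T\<^sup>-\<^sup>1 [0, 1)\<^sup>n\<close> has measure 1, being another fundamental domain of \<open>\<int>\<^sup>n\<close>.
\<close>

section \<open>Lattice automorphisms preserve volume\<close>

text \<open>A product measure is determined by its values on boxes. The preimage of a box is again a
  box, so the claim reduces to the affine rule for Lebesgue measure on the line. The sign
  \<open>r\<close> covers translations (\<open>r = 1\<close>) and the reflections x -> v - x
  (\<open>r = -1\<close>); both occur below.\<close>

lemma distr_PiM_lborel_affine:
  fixes v :: "'i \<Rightarrow> real"
  assumes "finite I" and "\<bar>r\<bar> = 1"
  defines "M \<equiv> \<Pi>\<^sub>M i\<in>I. (lborel :: real measure)"
  shows "distr M M (\<lambda>x. \<lambda>i\<in>I. v i + r * x i) = M"
proof -
  interpret product_sigma_finite "\<lambda>_::'i. lborel :: real measure"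
    by standard
  have [measurable]: "(\<lambda>x. \<lambda>i\<in>I. v i + r * x i) \<in> M \<rightarrow>\<^sub>M M"
    unfolding M_def by measurable
  have "distr M M (\<lambda>x. \<lambda>i\<in>I. v i + r * x i) = PiM I (\<lambda>_. lborel)"
  proof (rule PiM_eqI)
    show "finite I" by fact
    show "sets (distr M M (\<lambda>x. \<lambda>i\<in>I. v i + r * x i)) = sets (PiM I (\<lambda>_. lborel))"
      by (simp add: M_def)
    fix A :: "'i \<Rightarrow> real set" assume A: "\<And>i. i \<in> I \<Longrightarrow> A i \<in> sets lborel"
    have one: "emeasure lborel ((\<lambda>t. v i + r * t) -` A i) = emeasure lborel (A i)" if "i \<in> I" for i
    proof -
      have m: "(\<lambda>t. v i + r * t) \<in> lborel \<rightarrow>\<^sub>M lborel" by measurable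
      have "emeasure lborel (A i) =
          emeasure (density (distr lborel borel (\<lambda>t. v i + r * t)) (\<lambda>_. \<bar>r\<bar>)) (A i)"
        using lborel_real_affine[of r "v i"] assms(2) by auto
      also have "\<dots> = emeasure (distr lborel lborel (\<lambda>t. v i + r * t)) (A i)"
        using assms(2) by (simp add: density_1 cong: distr_cong)
      also have "\<dots> = emeasure lborel ((\<lambda>t. v i + r * t) -` A i)"
        using A[OF that] m by (subst emeasure_distr) auto
      finally show ?thesis by simp
    qed
    have "emeasure (distr M M (\<lambda>x. \<lambda>i\<in>I. v i + r * x i)) (Pi\<^sub>E I A)
        = emeasure M ((\<lambda>x. \<lambda>i\<in>I. v i + r * x i) -` Pi\<^sub>E I A \<inter> space M)"
      using A assms(1) by (intro emeasure_distr) (auto simp: M_def intro!: sets_PiM_I_finite)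
    also have "(\<lambda>x. \<lambda>i\<in>I. v i + r * x i) -` Pi\<^sub>E I A \<inter> space M
        = Pi\<^sub>E I (\<lambda>i. (\<lambda>t. v i + r * t) -` A i)"
      by (auto simp: M_def space_PiM PiE_iff)
    also have "emeasure M \<dots> = (\<Prod>i\<in>I. emeasure lborel ((\<lambda>t. v i + r * t) -` A i))"
      unfolding M_def using A assms(1)
      by (intro emeasure_PiM) (auto intro!: measurable_sets_borel[of _ borel])
    finally show "emeasure (distr M M (\<lambda>x. \<lambda>i\<in>I. v i + r * x i)) (Pi\<^sub>E I A)
        = (\<Prod>i\<in>I. emeasure lborel (A i))"
      by (simp only: one cong: prod.cong)
  qed
  then show ?thesis by (simp add: M_def)
qed

lemma nn_integral_PiM_lborel_affine:
  fixes v :: "'i \<Rightarrow> real"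
  assumes "finite I" and "\<bar>r\<bar> = 1" and f: "f \<in> borel_measurable (\<Pi>\<^sub>M i\<in>I. lborel)"
  shows "(\<integral>\<^sup>+x. f (\<lambda>i\<in>I. v i + r * x i) \<partial>(\<Pi>\<^sub>M i\<in>I. lborel)) = (\<integral>\<^sup>+x. f x \<partial>(\<Pi>\<^sub>M i\<in>I. lborel))"
proof -
  have "(\<lambda>x. \<lambda>i\<in>I. v i + r * x i) \<in> (\<Pi>\<^sub>M i\<in>I. lborel) \<rightarrow>\<^sub>M (\<Pi>\<^sub>M i\<in>I. lborel)"
    by measurable
  from nn_integral_distr[OF this, of f] show ?thesis
    using f distr_PiM_lborel_affine[OF assms(1,2), of v] by simp
qed

lemma emeasure_PiM_lborel_translate:
  fixes v :: "'i \<Rightarrow> real"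
  assumes "finite I" and A: "A \<in> sets (\<Pi>\<^sub>M i\<in>I. lborel)"
  shows "emeasure (\<Pi>\<^sub>M i\<in>I. lborel) {x \<in> I \<rightarrow>\<^sub>E UNIV. (\<lambda>i\<in>I. v i + x i) \<in> A}
    = emeasure (\<Pi>\<^sub>M i\<in>I. lborel) A"
proof -
  have m: "(\<lambda>x. \<lambda>i\<in>I. v i + 1 * x i) \<in> (\<Pi>\<^sub>M i\<in>I. lborel) \<rightarrow>\<^sub>M (\<Pi>\<^sub>M i\<in>I. lborel)"
    by measurable
  have "{x \<in> I \<rightarrow>\<^sub>E UNIV. (\<lambda>i\<in>I. v i + x i) \<in> A}
      = (\<lambda>x. \<lambda>i\<in>I. v i + 1 * x i) -` A \<inter> space (\<Pi>\<^sub>M i\<in>I. lborel)"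
    by (auto simp: space_PiM)
  then show ?thesis
    using emeasure_distr[OF m A] distr_PiM_lborel_affine[OF assms(1), of 1 v] by simp
qed

text \<open>An automorphism of the integer lattice, extended to real coordinates.
  \<open>T_lattice\<close> makes the preimage of the unit cube a fundamental domain.
  \<open>T_surj\<close> supplies the real preimages by which integrals get translated.\<close>

locale lattice_automorphism =
  fixes I :: "'i set" and T :: "('i \<Rightarrow> real) \<Rightarrow> 'i \<Rightarrow> real"
  assumes finite_I: "finite I"
    and T_measurable [measurable]: "T \<in> (\<Pi>\<^sub>M i\<in>I. lborel) \<rightarrow>\<^sub>M (\<Pi>\<^sub>M i\<in>I. lborel)"
    and T_add: "x \<in> I \<rightarrow>\<^sub>E UNIV \<Longrightarrow> y \<in> I \<rightarrow>\<^sub>E UNIV \<Longrightarrow>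
      T (\<lambda>i\<in>I. x i + y i) = (\<lambda>i\<in>I. T x i + T y i)"
    and T_surj: "y \<in> I \<rightarrow>\<^sub>E UNIV \<Longrightarrow> \<exists>x\<in>I \<rightarrow>\<^sub>E UNIV. T x = y"
    and T_lattice: "bij_betw T (I \<rightarrow>\<^sub>E \<int>) (I \<rightarrow>\<^sub>E \<int>)"
begin

abbreviation M :: "('i \<Rightarrow> real) measure" where "M \<equiv> \<Pi>\<^sub>M i\<in>I. lborel"

text \<open>The cubes are half-open so that those with integer corners tile the space without
  overlaps.\<close>

definition cell :: "('i \<Rightarrow> real) \<Rightarrow> ('i \<Rightarrow> real) set" where
  "cell w = (\<Pi>\<^sub>E i\<in>I. {w i..<w i + 1})"

lemma cell_sets [measurable]: "cell w \<in> sets M"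
  unfolding cell_def using finite_I by (intro sets_PiM_I_finite) auto

lemma emeasure_cell: "emeasure M (cell w) = 1"
proof -
  interpret product_sigma_finite "\<lambda>_::'i. lborel :: real measure"
    by standard
  show ?thesis
    unfolding cell_def using finite_I by (subst emeasure_PiM) auto
qed

lemma T_space: "x \<in> I \<rightarrow>\<^sub>E UNIV \<Longrightarrow> T x \<in> I \<rightarrow>\<^sub>E UNIV"
  using measurable_space[OF T_measurable, of x] by (simp add: space_PiM)

lemma countable_lattice: "countable (I \<rightarrow>\<^sub>E (\<int> :: real set))"
  using finite_I by (intro countable_PiE) (auto simp: Ints_def)

lemma disjoint_cell: "disjoint_family_on cell (I \<rightarrow>\<^sub>E \<int>)"
proof (unfold disjoint_family_on_def, intro ballI impI, rule ccontr)
  fix v w assume v: "v \<in> I \<rightarrow>\<^sub>E \<int>" and w: "w \<in> I \<rightarrow>\<^sub>E \<int>" and "v \<noteq> w"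
    and "cell v \<inter> cell w \<noteq> {}"
  then obtain x where x: "x \<in> cell v" "x \<in> cell w" by auto
  have "v i = w i" if "i \<in> I" for i
  proof -
    have "v i \<in> \<int>" "w i \<in> \<int>"
      using v w that by auto
    then obtain k l where kl: "v i = of_int k" "w i = of_int l"
      by (auto elim!: Ints_cases)
    have "v i \<le> x i" "x i < v i + 1" "w i \<le> x i" "x i < w i + 1"
      using x that by (auto simp: cell_def PiE_iff)
    then have "of_int k < (of_int (l + 1) :: real)" "of_int l < (of_int (k + 1) :: real)"
      unfolding kl by simp_all
    then have "k = l" unfolding of_int_less_iff by simp
    then show ?thesis by (simp add: kl)
  qed
  then have "v = w" using v w by (intro PiE_ext) auto
  with \<open>v \<noteq> w\<close> show False by simp
qed

lemma UN_cell: "(\<Union>w\<in>I \<rightarrow>\<^sub>E \<int>. cell w) = I \<rightarrow>\<^sub>E UNIV"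
proof (intro equalityI subsetI)
  fix x :: "'i \<Rightarrow> real" assume x: "x \<in> I \<rightarrow>\<^sub>E UNIV"
  then have "x \<in> cell (\<lambda>i\<in>I. of_int \<lfloor>x i\<rfloor>)"
    by (auto simp: cell_def PiE_iff) 
  moreover have "(\<lambda>i\<in>I. of_int \<lfloor>x i\<rfloor>) \<in> I \<rightarrow>\<^sub>E (\<int> :: real set)" by auto
  ultimately show "x \<in> (\<Union>w\<in>I \<rightarrow>\<^sub>E \<int>. cell w)" by blast
qed (auto simp: cell_def)

text \<open>Two fundamental domains of one lattice have equal measure. The preimage of the unit cube
  is cut along the integer cells, and the piece in \<open>cell z\<close> is moved by -z into the
  unit cube. There it becomes the set of x with T x in the cell at -T z. As z runs through the
  lattice so does -T z, hence the moved pieces partition the unit cube.\<close>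

lemma emeasure_vimage_cell:
  "emeasure M {x \<in> I \<rightarrow>\<^sub>E UNIV. T x \<in> cell (\<lambda>_. 0)} = 1"
proof -
  let ?Z = "I \<rightarrow>\<^sub>E (\<int> :: real set)"
  let ?pre = "\<lambda>w. {x \<in> I \<rightarrow>\<^sub>E UNIV. T x \<in> cell w}"
  let ?neg = "\<lambda>x. \<lambda>i\<in>I. - x i :: real"
  have pre [measurable]: "?pre w \<in> sets M" for w
  proof -
    have "?pre w = T -` cell w \<inter> space M" by (auto simp: space_PiM)
    then show ?thesis by simp
  qed
  have "bij_betw ?neg ?Z ?Z"
    by (rule bij_betw_byWitness[where f' = ?neg]) (auto simp: PiE_iff extensional_def fun_eq_iff)
  then have neg: "bij_betw (\<lambda>z. ?neg (T z)) ?Z ?Z"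
    using bij_betw_trans[OF T_lattice] by (simp add: o_def)
  have shift: "emeasure M (?pre (\<lambda>_. 0) \<inter> cell z) = emeasure M (cell (\<lambda>_. 0) \<inter> ?pre (?neg (T z)))"
    if z: "z \<in> ?Z" for z
  proof -
    have zU: "z \<in> I \<rightarrow>\<^sub>E UNIV" using z by auto
    have "emeasure M (?pre (\<lambda>_. 0) \<inter> cell z) =
        emeasure M {x \<in> I \<rightarrow>\<^sub>E UNIV. (\<lambda>i\<in>I. z i + x i) \<in> ?pre (\<lambda>_. 0) \<inter> cell z}"
      using finite_I by (intro emeasure_PiM_lborel_translate[symmetric]) auto
    also have "{x \<in> I \<rightarrow>\<^sub>E UNIV. (\<lambda>i\<in>I. z i + x i) \<in> ?pre (\<lambda>_. 0) \<inter> cell z} =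
        cell (\<lambda>_. 0) \<inter> ?pre (?neg (T z))"
    \<comment> \<open>By additivity, T (z + x) lies in the unit cube exactly when T x lies in the
      unit cube translated by -T z.\<close>
    proof (rule set_eqI)
      fix x
      show "x \<in> {x \<in> I \<rightarrow>\<^sub>E UNIV. (\<lambda>i\<in>I. z i + x i) \<in> ?pre (\<lambda>_. 0) \<inter> cell z} \<longleftrightarrow>
          x \<in> cell (\<lambda>_. 0) \<inter> ?pre (?neg (T z))"
      proof (cases "x \<in> I \<rightarrow>\<^sub>E UNIV")
        case True
        have "T x \<in> extensional I" using T_space[OF True] by (simp add: PiE_iff)
        then show ?thesis
          using True T_add[OF zU True] by (auto simp: cell_def PiE_iff algebra_simps)
      qed (auto simp: cell_def)
    qed
    finally show ?thesis .
  qed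
  have disj: "disjoint_family_on (\<lambda>z. X \<inter> cell z) ?Z" for X
    using disjoint_cell unfolding disjoint_family_on_def by blast
  have disj_pre: "disjoint_family_on (\<lambda>w. X \<inter> ?pre w) ?Z" for X
    unfolding disjoint_family_on_def
  proof (intro ballI impI)
    fix v w assume "v \<in> ?Z" "w \<in> ?Z" "v \<noteq> w"
    then have "cell v \<inter> cell w = {}"
      using disjoint_cell unfolding disjoint_family_on_def by blast
    then show "X \<inter> ?pre v \<inter> (X \<inter> ?pre w) = {}" by blast
  qed
  have "emeasure M (?pre (\<lambda>_. 0)) = emeasure M (\<Union>z\<in>?Z. ?pre (\<lambda>_. 0) \<inter> cell z)"
    unfolding Int_UN_distrib[symmetric] UN_cell by (intro arg_cong[where f = "emeasure M"]) auto
  also have "\<dots> = (\<integral>\<^sup>+z. emeasure M (?pre (\<lambda>_. 0) \<inter> cell z) \<partial>count_space ?Z)"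
    by (intro emeasure_UN_countable countable_lattice disj sets.Int pre cell_sets)
  also have "\<dots> = (\<integral>\<^sup>+z. emeasure M (cell (\<lambda>_. 0) \<inter> ?pre (?neg (T z))) \<partial>count_space ?Z)"
    using shift by (intro nn_integral_cong) auto
  also have "\<dots> = (\<integral>\<^sup>+w. emeasure M (cell (\<lambda>_. 0) \<inter> ?pre w) \<partial>count_space ?Z)"
    by (rule nn_integral_bij_count_space[OF neg])
  also have "\<dots> = emeasure M (\<Union>w\<in>?Z. cell (\<lambda>_. 0) \<inter> ?pre w)"
    by (intro emeasure_UN_countable[symmetric] countable_lattice disj_pre sets.Int pre cell_sets)
  also have "(\<Union>w\<in>?Z. cell (\<lambda>_. 0) \<inter> ?pre w) = cell (\<lambda>_. 0)"
  proof (intro equalityI subsetI)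
    fix x assume "x \<in> cell (\<lambda>_. 0)"
    moreover from this have "x \<in> I \<rightarrow>\<^sub>E UNIV" by (auto simp: cell_def)
    moreover from T_space[OF this] obtain w where "w \<in> ?Z" "T x \<in> cell w"
      unfolding UN_cell[symmetric] by (rule UN_E)
    ultimately show "x \<in> (\<Union>w\<in>?Z. cell (\<lambda>_. 0) \<inter> ?pre w)"
      by (intro UN_I[of w]) simp_all
  qed simp_all
  finally show ?thesis by (simp add: emeasure_cell)
qed

text \<open>
  Haar uniqueness: \<open>\<integral>\<integral> 1\<^sub>C (T y) 1\<^sub>S (x + T y)\<close> is \<open>\<mu>(S) \<mu>(T\<^sup>-\<^sup>1 C)\<close> by translating \<open>x\<close> and,
  after translating \<open>y\<close> by a preimage of \<open>- x\<close> instead, \<open>\<mu>(T\<^sup>-\<^sup>1 S) \<mu>(- C)\<close>.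
\<close>
lemma emeasure_vimage:
  assumes S [measurable]: "S \<in> sets M"
  shows "emeasure M {x \<in> I \<rightarrow>\<^sub>E UNIV. T x \<in> S} = emeasure M S"
proof -
  interpret product_sigma_finite "\<lambda>_::'i. lborel :: real measure"
    by standard
  interpret sM: sigma_finite_measure M
    using sigma_finite[OF finite_I] .
  interpret pair_sigma_finite M M ..
  let ?C = "cell (\<lambda>_. 0)"
  let ?add = "\<lambda>x y. \<lambda>i\<in>I. x i + y i :: real"
  have add_meas: "(\<lambda>(x, y). ?add x y) \<in> M \<Otimes>\<^sub>M M \<rightarrow>\<^sub>M M"
    unfolding case_prod_beta by measurable
  have sub_meas: "(\<lambda>(x, y). \<lambda>i\<in>I. x i - y i) \<in> M \<Otimes>\<^sub>M M \<rightarrow>\<^sub>M M"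
    unfolding case_prod_beta by measurable
  have add1: "(\<lambda>z. ?add (fst z) (T (snd z))) \<in> M \<Otimes>\<^sub>M M \<rightarrow>\<^sub>M M"
    using measurable_compose[OF measurable_Pair[OF measurable_fst
        measurable_compose[OF measurable_snd T_measurable]] add_meas]
    by (simp add: case_prod_beta)
  have sub1: "(\<lambda>z. \<lambda>i\<in>I. T (snd z) i - fst z i) \<in> M \<Otimes>\<^sub>M M \<rightarrow>\<^sub>M M"
    using measurable_compose[OF measurable_Pair[OF
        measurable_compose[OF measurable_snd T_measurable] measurable_fst] sub_meas]
    by (simp add: case_prod_beta)
  have ind_meas: "(\<lambda>z. indicator A (f z) :: ennreal) \<in> borel_measurable N"
    if "A \<in> sets M" "f \<in> N \<rightarrow>\<^sub>M M" for A f and N :: "'z measure"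
    using measurable_compose[OF that(2) borel_measurable_indicator[OF that(1)]] .
  have T_snd: "(\<lambda>z. T (snd z)) \<in> M \<Otimes>\<^sub>M M \<rightarrow>\<^sub>M M"
    by (rule measurable_compose[OF measurable_snd T_measurable])
  have set_eq: "{x \<in> I \<rightarrow>\<^sub>E UNIV. T x \<in> A} = T -` A \<inter> space M" for A
    by (auto simp: space_PiM)
  have ind: "emeasure M {x \<in> I \<rightarrow>\<^sub>E UNIV. T x \<in> A} = (\<integral>\<^sup>+y. indicator A (T y) \<partial>M)"
    if A [measurable]: "A \<in> sets M" for A
  proof -
    have "emeasure M (T -` A \<inter> space M) = (\<integral>\<^sup>+y. indicator (T -` A \<inter> space M) y \<partial>M)"
      by simp
    also have "\<dots> = (\<integral>\<^sup>+y. indicator A (T y) \<partial>M)"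
      by (intro nn_integral_cong) (auto simp: indicator_def)
    finally show ?thesis unfolding set_eq .
  qed
  \<comment> \<open>The measure of the preimage of the unit cube is 1, so it may be inserted as a
    factor. This produces the double integral to which both translations apply.\<close>
  have "emeasure M S = (\<integral>\<^sup>+y. indicator ?C (T y) \<partial>M) * (\<integral>\<^sup>+x. indicator S x \<partial>M)"
    using emeasure_vimage_cell ind[of ?C] by simp
  also have "\<dots> = (\<integral>\<^sup>+y. indicator ?C (T y) * (\<integral>\<^sup>+x. indicator S x \<partial>M) \<partial>M)"
    by (simp add: nn_integral_multc)
  also have "\<dots> = (\<integral>\<^sup>+y. \<integral>\<^sup>+x. indicator ?C (T y) * indicator S (?add x (T y)) \<partial>M \<partial>M)"
  proof (rule nn_integral_cong)
    fix y assume "y \<in> space M"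
    have "(\<integral>\<^sup>+x. indicator S x \<partial>M) = (\<integral>\<^sup>+x. indicator S (?add x (T y)) \<partial>M)"
      using nn_integral_PiM_lborel_affine[OF finite_I, of 1 "indicator S" "T y"]
      by (simp add: add.commute)
    moreover have "(\<lambda>x. ?add x (T y)) \<in> M \<rightarrow>\<^sub>M M" by measurable
    ultimately show "indicator ?C (T y) * (\<integral>\<^sup>+x. indicator S x \<partial>M)
      = (\<integral>\<^sup>+x. indicator ?C (T y) * indicator S (?add x (T y)) \<partial>M)"
      by (subst nn_integral_cmult) (auto intro: borel_measurable_indicator' measurable_compose[OF _ borel_measurable_indicator[OF S]])
  qed
  also have "\<dots> = (\<integral>\<^sup>+x. \<integral>\<^sup>+y. indicator ?C (T y) * indicator S (?add x (T y)) \<partial>M \<partial>M)"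
    using ind_meas[OF cell_sets T_snd] ind_meas[OF S add1]
    by (intro Fubini') (simp add: case_prod_beta borel_measurable_times_ennreal)
  also have "\<dots> = (\<integral>\<^sup>+x. \<integral>\<^sup>+y. indicator ?C (\<lambda>i\<in>I. T y i - x i) * indicator S (T y) \<partial>M \<partial>M)"
  proof (rule nn_integral_cong)
    fix x assume "x \<in> space M"
    then have x: "x \<in> I \<rightarrow>\<^sub>E UNIV" by (simp add: space_PiM)
    obtain z where z: "z \<in> I \<rightarrow>\<^sub>E UNIV" "T z = (\<lambda>i\<in>I. - x i)"
      using T_surj[of "\<lambda>i\<in>I. - x i"] by auto
    have m: "(\<lambda>y. indicator ?C (T y) * indicator S (?add x (T y)) :: ennreal) \<in> borel_measurable M"
    proof -
      have "(\<lambda>y. ?add x (T y)) \<in> M \<rightarrow>\<^sub>M M"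
        using measurable_compose[OF measurable_Pair1'[OF \<open>x \<in> space M\<close>] add1] by simp
      then show ?thesis
        by (intro borel_measurable_times_ennreal ind_meas) auto
    qed
    have "(\<integral>\<^sup>+y. indicator ?C (T y) * indicator S (?add x (T y)) \<partial>M) =
      (\<integral>\<^sup>+y. indicator ?C (T (\<lambda>i\<in>I. z i + 1 * y i)) * indicator S (?add x (T (\<lambda>i\<in>I. z i + 1 * y i))) \<partial>M)"
      by (rule nn_integral_PiM_lborel_affine[OF finite_I _ m, symmetric]) simp
    also have "\<dots> = (\<integral>\<^sup>+y. indicator ?C (\<lambda>i\<in>I. T y i - x i) * indicator S (T y) \<partial>M)"
    proof (rule nn_integral_cong)
      fix y assume "y \<in> space M"
      then have y: "y \<in> I \<rightarrow>\<^sub>E UNIV" by (simp add: space_PiM)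
      have 1: "T (\<lambda>i\<in>I. z i + 1 * y i) = (\<lambda>i\<in>I. T y i - x i)"
        using T_add[OF z(1) y] z(2) by (auto simp: fun_eq_iff)
      have 2: "?add x (\<lambda>i\<in>I. T y i - x i) = T y"
        using T_space[OF y] by (auto simp: fun_eq_iff PiE_iff extensional_def)
      show "indicator ?C (T (\<lambda>i\<in>I. z i + 1 * y i)) * indicator S (?add x (T (\<lambda>i\<in>I. z i + 1 * y i)))
        = (indicator ?C (\<lambda>i\<in>I. T y i - x i) * indicator S (T y) :: ennreal)"
        unfolding 1 2 ..
    qed
    finally show "(\<integral>\<^sup>+y. indicator ?C (T y) * indicator S (?add x (T y)) \<partial>M) =
      (\<integral>\<^sup>+y. indicator ?C (\<lambda>i\<in>I. T y i - x i) * indicator S (T y) \<partial>M)" .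
  qed
  also have "\<dots> = (\<integral>\<^sup>+y. \<integral>\<^sup>+x. indicator ?C (\<lambda>i\<in>I. T y i - x i) * indicator S (T y) \<partial>M \<partial>M)"
    using ind_meas[OF cell_sets sub1] ind_meas[OF S T_snd]
    by (intro Fubini'[symmetric]) (simp add: case_prod_beta borel_measurable_times_ennreal)
  also have "\<dots> = (\<integral>\<^sup>+y. indicator S (T y) \<partial>M)"
  proof (rule nn_integral_cong)
    fix y assume "y \<in> space M"
    \<comment> \<open>For fixed y the map x -> T y - x is a reflection followed by a translation, so
      the inner integral is the measure of the unit cube.\<close>
    have "(\<integral>\<^sup>+x. indicator ?C (\<lambda>i\<in>I. T y i - x i) \<partial>M) = (\<integral>\<^sup>+x. indicator ?C x \<partial>M)"
      using nn_integral_PiM_lborel_affine[OF finite_I, of "-1" "indicator ?C" "T y"] by simp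
    also have "\<dots> = 1" by (simp add: emeasure_cell)
    finally have 1: "(\<integral>\<^sup>+x. indicator ?C (\<lambda>i\<in>I. T y i - x i) \<partial>M) = 1" .
    have "(\<lambda>x. \<lambda>i\<in>I. T y i - x i) \<in> M \<rightarrow>\<^sub>M M" by measurable
    then have "(\<lambda>x. indicator ?C (\<lambda>i\<in>I. T y i - x i) :: ennreal) \<in> borel_measurable M"
      by measurable
    then show "(\<integral>\<^sup>+x. indicator ?C (\<lambda>i\<in>I. T y i - x i) * indicator S (T y) \<partial>M) = indicator S (T y)"
      using 1 by (simp add: nn_integral_multc)
  qed
  finally show ?thesis using ind[OF S] by simp
qed

end

section \<open>The Pitman--Stanley region\<close>

text \<open>\<open>s\<close> is the bound on the first coordinate \<open>y k\<close>, the sum over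
  \<open>{k<..k}\<close> being empty. It carries the budget left over from earlier coordinates, so
  that fixing \<open>y k\<close> leaves a region of the same form. Indices start at 0:
  \<open>y j\<close> stands for the flow on the arc from vertex \<open>Suc j\<close> to the
  sink.\<close>

definition ps_region :: "(nat \<Rightarrow> real) \<Rightarrow> nat \<Rightarrow> nat \<Rightarrow> real \<Rightarrow> (nat \<Rightarrow> real) set" where
  "ps_region \<alpha> n k s = {y \<in> {k..<n} \<rightarrow>\<^sub>E UNIV.
     \<forall>j\<in>{k..<n}. 0 \<le> y j \<and> (\<Sum>i=k..j. y i) \<le> s + (\<Sum>i\<in>{k<..j}. \<alpha> i)}"

lemma ps_region_sets [measurable]: "ps_region \<alpha> n k s \<in> sets (\<Pi>\<^sub>M i\<in>{k..<n}. lborel)"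
proof -
  have "ps_region \<alpha> n k s = {y \<in> space (\<Pi>\<^sub>M i\<in>{k..<n}. lborel).
     \<forall>j\<in>{k..<n}. 0 \<le> y j \<and> (\<Sum>i=k..j. y i) \<le> s + (\<Sum>i\<in>{k<..j}. \<alpha> i)}"
    by (simp add: ps_region_def space_PiM)
  also have "\<dots> \<in> sets (\<Pi>\<^sub>M i\<in>{k..<n}. lborel)"
  proof (intro sets.sets_Collect_finite_All sets.sets_Collect_conj)
    fix j assume j: "j \<in> {k..<n}"
    have comp: "(\<lambda>y. y i) \<in> borel_measurable (\<Pi>\<^sub>M i\<in>{k..<n}. lborel)" if "i \<in> {k..<n}" for i
      using measurable_component_singleton[OF that, of "\<lambda>_. lborel"] by simp
    show "{y \<in> space (\<Pi>\<^sub>M i\<in>{k..<n}. lborel). (0::real) \<le> y j} \<in> sets (\<Pi>\<^sub>M i\<in>{k..<n}. lborel)"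
      using borel_measurable_le[OF borel_measurable_const comp[OF j], of 0] by simp
    show "{y \<in> space (\<Pi>\<^sub>M i\<in>{k..<n}. lborel). (\<Sum>i=k..j. y i) \<le> s + (\<Sum>i\<in>{k<..j}. \<alpha> i)}
        \<in> sets (\<Pi>\<^sub>M i\<in>{k..<n}. lborel)"
      by (rule borel_measurable_le[OF borel_measurable_sum borel_measurable_const])
         (use j in \<open>auto intro: comp\<close>)
  qed auto
  finally show ?thesis .
qed

text \<open>Choosing \<open>t\<close> uses up \<open>t\<close> of the budget \<open>s\<close>, and
  the next coordinate adds \<alpha> at \<open>Suc k\<close>. If \<open>Suc k = n\<close>, the
  remaining region lives over the empty index set and contains the empty function whatever the
  budget.\<close>

lemma fun_upd_in_ps_region_iff:
  assumes "k < n" and z: "z \<in> {Suc k..<n} \<rightarrow>\<^sub>E UNIV"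
  shows "z(k := t) \<in> ps_region \<alpha> n k s \<longleftrightarrow>
    t \<in> {0..s} \<and> z \<in> ps_region \<alpha> n (Suc k) (s - t + \<alpha> (Suc k))"
proof -
  have "{k..<n} = insert k {Suc k..<n}" using assms(1) by auto
  moreover have "(\<Sum>i=k..j. (z(k := t)) i) \<le> s + (\<Sum>i\<in>{k<..j}. \<alpha> i) \<longleftrightarrow>
      (\<Sum>i=Suc k..j. z i) \<le> s - t + \<alpha> (Suc k) + (\<Sum>i\<in>{Suc k<..j}. \<alpha> i)"
    if "j \<in> {Suc k..<n}" for j
  proof -
    have "{k<..j} = insert (Suc k) {Suc k<..j}" using that by auto
    moreover have "{k..j} = insert k {Suc k..j}" using that by auto
    moreover have "(\<Sum>i=Suc k..j. (z(k := t)) i) = (\<Sum>i=Suc k..j. z i)"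
      by (intro sum.cong) auto
    ultimately show ?thesis by (simp add: algebra_simps)
  qed
  ultimately show ?thesis
    using z by (auto simp: ps_region_def PiE_iff extensional_def)
qed

text \<open>Fubini with the coordinate \<open>k\<close> as the outermost variable.\<close>

lemma emeasure_ps_region_rec:
  assumes "k < n"
  shows "emeasure (\<Pi>\<^sub>M i\<in>{k..<n}. lborel) (ps_region \<alpha> n k s) =
    (\<integral>\<^sup>+t\<in>{0..s}. emeasure (\<Pi>\<^sub>M i\<in>{Suc k..<n}. lborel)
       (ps_region \<alpha> n (Suc k) (s - t + \<alpha> (Suc k))) \<partial>lborel)"
proof -
  interpret product_sigma_finite "\<lambda>_::nat. lborel :: real measure"
    by standard
  have ins: "{k..<n} = insert k {Suc k..<n}" using assms by auto
  have "emeasure (\<Pi>\<^sub>M i\<in>{k..<n}. lborel) (ps_region \<alpha> n k s) =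
      (\<integral>\<^sup>+y. indicator (ps_region \<alpha> n k s) y \<partial>(\<Pi>\<^sub>M i\<in>{k..<n}. lborel))"
    by simp
  also have "\<dots> = (\<integral>\<^sup>+t. \<integral>\<^sup>+z. indicator (ps_region \<alpha> n k s) (z(k := t))
      \<partial>(\<Pi>\<^sub>M i\<in>{Suc k..<n}. lborel) \<partial>lborel)"
    unfolding ins
    by (intro product_nn_integral_insert_rev borel_measurable_indicator)
       (use ps_region_sets[of \<alpha> n k s] ins in auto)
  also have "\<dots> = (\<integral>\<^sup>+t. emeasure (\<Pi>\<^sub>M i\<in>{Suc k..<n}. lborel)
       (ps_region \<alpha> n (Suc k) (s - t + \<alpha> (Suc k))) * indicator {0..s} t \<partial>lborel)"
  proof (rule nn_integral_cong)
    fix t :: real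
    have "(\<integral>\<^sup>+z. indicator (ps_region \<alpha> n k s) (z(k := t)) \<partial>(\<Pi>\<^sub>M i\<in>{Suc k..<n}. lborel)) =
      (\<integral>\<^sup>+z. indicator (ps_region \<alpha> n (Suc k) (s - t + \<alpha> (Suc k))) z * indicator {0..s} t
        \<partial>(\<Pi>\<^sub>M i\<in>{Suc k..<n}. lborel))"
      using fun_upd_in_ps_region_iff[OF assms]
      by (intro nn_integral_cong) (auto simp: space_PiM indicator_def)
    then show "(\<integral>\<^sup>+z. indicator (ps_region \<alpha> n k s) (z(k := t)) \<partial>(\<Pi>\<^sub>M i\<in>{Suc k..<n}. lborel)) =
      emeasure (\<Pi>\<^sub>M i\<in>{Suc k..<n}. lborel)
       (ps_region \<alpha> n (Suc k) (s - t + \<alpha> (Suc k))) * indicator {0..s} t"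
      by (simp add: nn_integral_multc)
  qed
  finally show ?thesis .
qed

section \<open>Closed form of the volume through Abel polynomials\<close>

text \<open>This is the Abel polynomial x (x - m d)^(m - 1) with d = -c, divided by m!. The case
  \<open>m = 0\<close> is separate because truncated subtraction would turn the formula into s
  instead of 1.\<close>

definition ps_vol :: "real \<Rightarrow> nat \<Rightarrow> real \<Rightarrow> real" where
  "ps_vol c m s = (if m = 0 then 1 else s * (s + real m * c) ^ (m - 1) / fact m)"

lemma ps_vol_nonneg: "0 \<le> c \<Longrightarrow> 0 \<le> s \<Longrightarrow> 0 \<le> ps_vol c m s"
  by (simp add: ps_vol_def)

lemma DERIV_ps_vol: "(ps_vol c (Suc m) has_real_derivative ps_vol c m (s + c)) (at s)"
proof (cases m)
  case 0
  then show ?thesis unfolding ps_vol_def by (auto intro!: derivative_eq_intros)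
next
  case (Suc l)
  have "((\<lambda>s. s * (s + real (Suc m) * c) ^ m / fact (Suc m)) has_real_derivative
      ((s + real (Suc m) * c) ^ m + s * (real m * (s + real (Suc m) * c) ^ (m - 1))) / fact (Suc m)) (at s)"
    by (auto intro!: derivative_eq_intros)
  also have "((s + real (Suc m) * c) ^ m + s * (real m * (s + real (Suc m) * c) ^ (m - 1))) / fact (Suc m)
      = ps_vol c m (s + c)"
  proof -
    \<comment> \<open>After extracting the common power, the remaining factor is s + (m + 1) c + m s
      = (m + 1) (s + c). The factor m + 1 then cancels against the factorial.\<close>
    have 1: "(s + real (Suc m) * c) ^ m + s * (real m * (s + real (Suc m) * c) ^ (m - 1))
      = real (Suc m) * ((s + c) * (s + real (Suc m) * c) ^ (m - 1))"
      unfolding Suc by (simp add: algebra_simps)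
    have "s + c + real m * c = s + real (Suc m) * c" by (simp add: algebra_simps)
    then show ?thesis
      unfolding ps_vol_def 1 fact_Suc \<open>s + c + real m * c = _\<close> using Suc by (simp del: of_nat_Suc fact_Suc)
  qed
  finally show ?thesis by (simp add: ps_vol_def[abs_def])
qed

text \<open>Differentiating \<open>ps_vol\<close> shifts its argument by \<open>c\<close>, so the
  antiderivative in \<open>t\<close> is taken at \<open>s - t + b - c\<close>. The argument
  \<open>b - c\<close> may be negative; nonnegativity is required of the integrand alone.\<close>

lemma nn_integral_ps_vol:
  assumes "0 \<le> c" and "0 \<le> s" and "0 \<le> b"
  shows "(\<integral>\<^sup>+t\<in>{0..s}. ennreal (ps_vol c m (s - t + b)) \<partial>lborel) =
    ennreal (ps_vol c (Suc m) (s + b - c) - ps_vol c (Suc m) (b - c))"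
proof -
  have "(\<integral>\<^sup>+t. ennreal (ps_vol c m (s - t + b)) * indicator {0..s} t \<partial>lborel) =
      ennreal (- ps_vol c (Suc m) (s - s + b - c) - - ps_vol c (Suc m) (s - 0 + b - c))"
  proof (rule nn_integral_FTC_Icc)
    show "(\<lambda>t. ps_vol c m (s - t + b)) \<in> borel_measurable borel"
      unfolding ps_vol_def by (cases "m = 0") (simp_all, measurable)
    fix t assume t: "t \<in> {0..s}"
    show "0 \<le> ps_vol c m (s - t + b)"
      using t assms by (intro ps_vol_nonneg) auto
    have "((\<lambda>t. - ps_vol c (Suc m) (s - t + b - c)) has_real_derivative
        - (ps_vol c m ((s - t + b - c) + c) * - 1)) (at t)"
      by (intro DERIV_minus DERIV_chain2[OF DERIV_ps_vol]) (auto intro!: derivative_eq_intros)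
    then show "((\<lambda>t. - ps_vol c (Suc m) (s - t + b - c)) has_real_derivative
        ps_vol c m (s - t + b)) (at t)"
      by simp
  qed (use assms in auto)
  then show ?thesis by simp
qed

text \<open>Downward induction on \<open>k\<close>, starting from the one-point region at
  \<open>k = n\<close>. With \<open>b = c\<close> the lower boundary term of the integral is
  \<open>ps_vol\<close> at 0, which vanishes in positive degree.\<close>

lemma emeasure_ps_region_const:
  assumes "0 \<le> c" and "k \<le> n" and "\<And>i. k < i \<Longrightarrow> i < n \<Longrightarrow> \<alpha> i = c" and "0 \<le> s"
  shows "emeasure (\<Pi>\<^sub>M i\<in>{k..<n}. lborel) (ps_region \<alpha> n k s) = ennreal (ps_vol c (n - k) s)"
  using assms(2-4)
proof (induction arbitrary: s rule: inc_induct)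
  case base
  interpret product_sigma_finite "\<lambda>_::nat. lborel :: real measure"
    by standard
  show ?case by (simp add: ps_region_def ps_vol_def emeasure_PiM_empty PiM_empty)
next
  case (step k)
  show ?case
  proof (cases "Suc k = n")
    \<comment> \<open>The hypothesis on \<alpha> stops before index \<open>n\<close>, so the last
      coordinate is handled directly: the integrand is 1 and the integral is the length
      \<open>s\<close>.\<close>
    case True
    then have "n - k = Suc 0" using step by simp
    then show ?thesis
      unfolding emeasure_ps_region_rec[OF \<open>k < n\<close>] using True step.prems
      by (simp add: ps_region_def ps_vol_def PiM_empty)
  next
    case False
    then have \<alpha>: "\<alpha> (Suc k) = c" using step by auto
    have "emeasure (\<Pi>\<^sub>M i\<in>{k..<n}. lborel) (ps_region \<alpha> n k s) =
      (\<integral>\<^sup>+t\<in>{0..s}. ennreal (ps_vol c (n - Suc k) (s - t + c)) \<partial>lborel)"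
      unfolding emeasure_ps_region_rec[OF \<open>k < n\<close>] \<alpha>
      using step assms(1) by (intro nn_integral_cong) (auto simp: indicator_def)
    also have "\<dots> = ennreal (ps_vol c (Suc (n - Suc k)) (s + c - c) - ps_vol c (Suc (n - Suc k)) (c - c))"
      by (intro nn_integral_ps_vol assms(1) step.prems)
    also have "ps_vol c (Suc (n - Suc k)) (c - c) = 0" by (simp add: ps_vol_def)
    finally show ?thesis using \<open>k < n\<close> by (simp add: Suc_diff_Suc)
  qed
qed

text \<open>One recursion step with budget \<open>a\<close> leads to regions with budget
  \<open>a - t + b\<close> whose later increments all equal \<open>c\<close>; their volumes are
  known, and one more integration gives the difference of two values of
  \<open>ps_vol\<close>.\<close>

lemma measure_ps_region:
  fixes a b c :: real
  assumes "0 \<le> a" and "0 \<le> b" and "0 \<le> c" and "1 \<le> n"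
  shows "measure (\<Pi>\<^sub>M i\<in>{0..<n}. lborel) (ps_region (\<lambda>i. if i = 1 then b else c) n 0 a) =
    ((a + b - c) * (a + b + (real n - 1) * c) ^ (n - 1)
      - (b - c) * (b + (real n - 1) * c) ^ (n - 1)) / fact n"
proof -
  let ?\<alpha> = "\<lambda>i::nat. if i = 1 then b else c"
  have "emeasure (\<Pi>\<^sub>M i\<in>{0..<n}. lborel) (ps_region ?\<alpha> n 0 a) =
      (\<integral>\<^sup>+t\<in>{0..a}. ennreal (ps_vol c (n - 1) (a - t + b)) \<partial>lborel)"
    using assms
    by (subst emeasure_ps_region_rec)
       (auto intro!: nn_integral_cong emeasure_ps_region_const simp: indicator_def)
  also have "\<dots> = ennreal (ps_vol c (Suc (n - 1)) (a + b - c) - ps_vol c (Suc (n - 1)) (b - c))"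
    by (intro nn_integral_ps_vol assms)
  finally have "emeasure (\<Pi>\<^sub>M i\<in>{0..<n}. lborel) (ps_region ?\<alpha> n 0 a) =
    ennreal (ps_vol c n (a + b - c) - ps_vol c n (b - c))"
    using assms by simp
  \<comment> \<open>\<open>ennreal\<close> truncates negative reals to 0, so the difference can be
    read off as a real only once it is known to be nonnegative. The derivative at x is
    \<open>ps_vol\<close> at x + c, and x + c is at least b.\<close>
  moreover have "ps_vol c n (b - c) \<le> ps_vol c n (a + b - c)"
  proof -
    have "\<exists>y. ((\<lambda>s. ps_vol c (Suc (n - 1)) s) has_real_derivative y) (at x) \<and> 0 \<le> y"
      if "b - c \<le> x" "x \<le> a + b - c" for x
      using DERIV_ps_vol[of c "n - 1" x] ps_vol_nonneg[of c "x + c" "n - 1"] that assms by auto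
    from DERIV_nonneg_imp_nondecreasing[OF _ this] show ?thesis
      using assms by simp
  qed
  ultimately have "measure (\<Pi>\<^sub>M i\<in>{0..<n}. lborel) (ps_region ?\<alpha> n 0 a) =
      ps_vol c n (a + b - c) - ps_vol c n (b - c)"
    by (simp add: measure_def)
  also have "\<dots> = ((a + b - c) * (a + b + (real n - 1) * c) ^ (n - 1)
      - (b - c) * (b + (real n - 1) * c) ^ (n - 1)) / fact n"
  proof -
    have "a + b - c + real n * c = a + b + (real n - 1) * c" "b - c + real n * c = b + (real n - 1) * c"
      by (simp_all add: algebra_simps)
    then show ?thesis using assms by (simp only: ps_vol_def diff_divide_distrib) simp
  qed
  finally show ?thesis .
qed

section \<open>Flows on the Pitman--Stanley graph\<close>

lemma arcs_pitman_stanley: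
  "arcs (pitman_stanley (n + 2)) = (\<lambda>i. (i, Suc i)) ` {1..n + 1} \<union> (\<lambda>i. (i, n + 2)) ` {1..n}"
  by (auto simp: pitman_stanley_def)

lemma verts_pitman_stanley: "verts (pitman_stanley (n + 2)) = {1..n + 2}"
  by (simp add: pitman_stanley_def)

text \<open>The arc \<open>(n + 1, n + 2)\<close> is counted among the path arcs; the spokes into
  the sink start at vertices up to \<open>n\<close>, which makes the two families disjoint.\<close>

lemma net_flow_pitman_stanley:
  fixes b :: "nat \<times> nat \<Rightarrow> 'r::comm_ring_1"
  shows "net_flow (pitman_stanley (n + 2)) b v =
    (\<Sum>i=1..n + 1. b (i, Suc i) * (of_bool (v = i) - of_bool (v = Suc i))) +
    (\<Sum>i=1..n. b (i, n + 2) * (of_bool (v = i) - of_bool (v = n + 2)))"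
proof -
  have "(\<lambda>i. (i, Suc i)) ` {1..n + 1} \<inter> (\<lambda>i. (i, n + 2)) ` {1..n} = {}"
    by auto
  moreover have "tail (pitman_stanley (n + 2)) = fst" "head (pitman_stanley (n + 2)) = snd"
    by (simp_all add: pitman_stanley_def)
  ultimately show ?thesis
    unfolding net_flow_def arcs_pitman_stanley
    by (subst sum.union_disjoint) (auto simp: sum.reindex inj_on_def)
qed

text \<open>Arcs inside \<open>{1..j}\<close> cancel, and no arc enters this set because arcs go
  upward. What leaves it is the path arc at \<open>j\<close> and the spokes at vertices up to
  \<open>j\<close>. The minimum accounts for \<open>j = n + 1\<close>, a vertex without a spoke of
  its own.\<close>

lemma sum_net_flow_pitman_stanley:
  fixes b :: "nat \<times> nat \<Rightarrow> 'r::comm_ring_1"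
  assumes "j \<in> {1..n + 1}"
  shows "(\<Sum>v=1..j. net_flow (pitman_stanley (n + 2)) b v) =
    b (j, Suc j) + (\<Sum>i=1..min j n. b (i, n + 2))"
proof -
  have cut: "(\<Sum>v=1..j. of_bool (v = i) :: 'r) = of_bool (i \<in> {1..j})" for i
    by (simp add: of_bool_def)
  have "(\<Sum>v=1..j. net_flow (pitman_stanley (n + 2)) b v) =
      (\<Sum>i=1..n + 1. b (i, Suc i) * (of_bool (i \<in> {1..j}) - of_bool (Suc i \<in> {1..j}))) +
      (\<Sum>i=1..n. b (i, n + 2) * (of_bool (i \<in> {1..j}) - of_bool (n + 2 \<in> {1..j})))"
    unfolding net_flow_pitman_stanley sum.distrib
    by (subst (1 2) sum.swap) (simp only: sum_distrib_left[symmetric] sum_subtractf cut)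
  also have "(\<Sum>i=1..n + 1. b (i, Suc i) * (of_bool (i \<in> {1..j}) - of_bool (Suc i \<in> {1..j}))) =
      (\<Sum>i=1..n + 1. if i = j then b (i, Suc i) else 0)"
    using assms by (intro sum.cong) auto
  also have "\<dots> = b (j, Suc j)" using assms by simp
  also have "(\<Sum>i=1..n. b (i, n + 2) * (of_bool (i \<in> {1..j}) - of_bool (n + 2 \<in> {1..j}))) =
      (\<Sum>i=1..min j n. b (i, n + 2))"
    using assms by (intro sum.mono_neutral_cong_right) auto
  finally show ?thesis .
qed

lemma sum_net_flow_pitman_stanley_total:
  fixes b :: "nat \<times> nat \<Rightarrow> 'r::comm_ring_1"
  shows "(\<Sum>v=1..n + 2. net_flow (pitman_stanley (n + 2)) b v) = 0"
proof -
  have cut: "(\<Sum>v=1..n + 2. of_bool (v = i) :: 'r) = of_bool (i \<in> {1..n + 2})" for i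
    by (simp add: of_bool_def)
  have "(\<Sum>v=1..n + 2. net_flow (pitman_stanley (n + 2)) b v) =
      (\<Sum>i=1..n + 1. b (i, Suc i) * (of_bool (i \<in> {1..n + 2}) - of_bool (Suc i \<in> {1..n + 2}))) +
      (\<Sum>i=1..n. b (i, n + 2) * (of_bool (i \<in> {1..n + 2}) - of_bool (n + 2 \<in> {1..n + 2})))"
    unfolding net_flow_pitman_stanley sum.distrib
    by (subst (1 2) sum.swap) (simp only: sum_distrib_left[symmetric] sum_subtractf cut)
  also have "(\<Sum>i=1..n + 1. b (i, Suc i) * (of_bool (i \<in> {1..n + 2}) - of_bool (Suc i \<in> {1..n + 2}))) = 0"
    by (intro sum.neutral) auto
  also have "(\<Sum>i=1..n. b (i, n + 2) * (of_bool (i \<in> {1..n + 2}) - of_bool (n + 2 \<in> {1..n + 2}))) = 0"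
    by (intro sum.neutral) auto
  finally show ?thesis by simp
qed

text \<open>Passing to prefix sums is invertible, and each prefix sum isolates one path arc. The
  equation at the sink \<open>n + 2\<close> is the balance of totals, which is where the hypothesis
  on \<alpha> enters.\<close>

lemma net_flow_pitman_stanley_eq_iff:
  fixes b :: "nat \<times> nat \<Rightarrow> 'r::comm_ring_1"
  assumes "(\<Sum>v=1..n + 2. \<alpha> v) = 0"
  shows "(\<forall>v\<in>{1..n + 2}. net_flow (pitman_stanley (n + 2)) b v = \<alpha> v) \<longleftrightarrow>
    (\<forall>j\<in>{1..n + 1}. b (j, Suc j) = (\<Sum>v=1..j. \<alpha> v) - (\<Sum>i=1..min j n. b (i, n + 2)))"
    (is "?L \<longleftrightarrow> ?R")
proof
  assume ?L
  show ?R
  proof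
    fix j assume j: "j \<in> {1..n + 1}"
    have "(\<Sum>v=1..j. \<alpha> v) = (\<Sum>v=1..j. net_flow (pitman_stanley (n + 2)) b v)"
      using \<open>?L\<close> j by (intro sum.cong) auto
    then show "b (j, Suc j) = (\<Sum>v=1..j. \<alpha> v) - (\<Sum>i=1..min j n. b (i, n + 2))"
      unfolding sum_net_flow_pitman_stanley[OF j] by simp
  qed
next
  assume ?R
  let ?f = "net_flow (pitman_stanley (n + 2)) b"
  have partial: "(\<Sum>v=1..j. ?f v) = (\<Sum>v=1..j. \<alpha> v)" if le: "j \<le> n + 2" for j
  proof -
    consider "j = 0" | "j \<in> {1..n + 1}" | "j = n + 2" using le by fastforce
    then show ?thesis
    proof cases
      case 2
      then show ?thesis
        using \<open>?R\<close> unfolding sum_net_flow_pitman_stanley[OF 2] by simp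
    next
      case 3
      then show ?thesis
        using sum_net_flow_pitman_stanley_total[of n b] assms by simp
    qed simp
  qed
  show ?L
  proof
    fix v assume "v \<in> {1..n + 2}"
    then obtain w where w: "v = Suc w" "Suc w \<le> n + 2" by (cases v) auto
    show "?f v = \<alpha> v"
      using partial[of w] partial[of "Suc w"] w by simp
  qed
qed

text \<open>The flow with net flow \<alpha> and prescribed spoke values: the path arcs are solved
  from the cut equations. \<open>y\<close> is indexed from 0 and vertices from 1, hence
  \<open>y (i - 1)\<close>. The ring is left general so that one construction serves integer lattice
  vectors and real flows.\<close>

definition ps_flow ::
  "nat \<Rightarrow> (nat \<Rightarrow> 'r) \<Rightarrow> (nat \<Rightarrow> 'r) \<Rightarrow> nat \<times> nat \<Rightarrow> 'r::comm_ring_1" where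
  "ps_flow n \<alpha> y = (\<lambda>(i, j).
     if i \<in> {1..n} \<and> j = n + 2 then y (i - 1)
     else if i \<in> {1..n + 1} \<and> j = Suc i then (\<Sum>v=1..i. \<alpha> v) - (\<Sum>k=1..min i n. y (k - 1))
     else 0)"

definition ps_coords :: "nat \<Rightarrow> (nat \<times> nat \<Rightarrow> 'r) \<Rightarrow> nat \<Rightarrow> 'r" where
  "ps_coords n b = (\<lambda>i\<in>{..<n}. b (Suc i, n + 2))"

lemma ps_flow_bij_betw:
  fixes \<alpha> :: "nat \<Rightarrow> 'r::comm_ring_1"
  assumes "(\<Sum>v=1..n + 2. \<alpha> v) = 0"
  defines "F \<equiv> {b. (\<forall>e. e \<notin> arcs (pitman_stanley (n + 2)) \<longrightarrow> b e = 0) \<and>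
     (\<forall>v\<in>verts (pitman_stanley (n + 2)). net_flow (pitman_stanley (n + 2)) b v = \<alpha> v)}"
  shows "bij_betw (ps_coords n) F ({..<n} \<rightarrow>\<^sub>E UNIV)"
    and "bij_betw (ps_flow n \<alpha>) ({..<n} \<rightarrow>\<^sub>E UNIV) F"
proof -
  have F: "b \<in> F \<longleftrightarrow> (\<forall>e. e \<notin> arcs (pitman_stanley (n + 2)) \<longrightarrow> b e = 0) \<and>
    (\<forall>j\<in>{1..n + 1}. b (j, Suc j) = (\<Sum>v=1..j. \<alpha> v) - (\<Sum>i=1..min j n. b (i, n + 2)))" for b
    using net_flow_pitman_stanley_eq_iff[OF assms(1), of b]
    unfolding F_def verts_pitman_stanley by blast
  have 1: "ps_flow n \<alpha> (ps_coords n b) = b" if "b \<in> F" for b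
  proof
    fix e :: "nat \<times> nat"
    obtain i j where e: "e = (i, j)" by fastforce
    have "(\<Sum>k=1..min i n. ps_coords n b (k - 1)) = (\<Sum>k=1..min i n. b (k, n + 2))"
      by (intro sum.cong) (auto simp: ps_coords_def)
    moreover have "b (i, Suc i) = (\<Sum>v=1..i. \<alpha> v) - (\<Sum>k=1..min i n. b (k, n + 2))"
      if "i \<in> {1..n + 1}"
      using \<open>b \<in> F\<close> that unfolding F by blast
    moreover have "b (i, j) = 0" if "\<not> (i \<in> {1..n} \<and> j = n + 2)" "\<not> (i \<in> {1..n + 1} \<and> j = Suc i)"
    proof -
      have "(i, j) \<notin> arcs (pitman_stanley (n + 2))"
        using that unfolding arcs_pitman_stanley by auto
      then show ?thesis using \<open>b \<in> F\<close> unfolding F by blast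
    qed
    ultimately show "ps_flow n \<alpha> (ps_coords n b) e = b e"
      unfolding e ps_flow_def by (auto simp: ps_coords_def)
  qed
  have 2: "ps_coords n (ps_flow n \<alpha> y) = y" if "y \<in> {..<n} \<rightarrow>\<^sub>E UNIV" for y
  proof
    fix i show "ps_coords n (ps_flow n \<alpha> y) i = y i"
      using PiE_arb[OF that, of i] by (cases "i < n") (simp_all add: ps_coords_def ps_flow_def)
  qed
  have 3: "ps_flow n \<alpha> y \<in> F" for y
  proof -
    have "(\<Sum>i=1..min j n. ps_flow n \<alpha> y (i, n + 2)) = (\<Sum>k=1..min j n. y (k - 1))" for j
      by (intro sum.cong) (auto simp: ps_flow_def)
    moreover have "ps_flow n \<alpha> y (j, Suc j) = (\<Sum>v=1..j. \<alpha> v) - (\<Sum>k=1..min j n. y (k - 1))"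
      if "j \<in> {1..n + 1}" for j
      using that by (auto simp: ps_flow_def)
    ultimately show ?thesis
      unfolding F arcs_pitman_stanley by (auto simp: ps_flow_def)
  qed
  have 4: "ps_coords n b \<in> {..<n} \<rightarrow>\<^sub>E UNIV" for b :: "nat \<times> nat \<Rightarrow> 'r"
    by (simp add: ps_coords_def)
  show "bij_betw (ps_coords n) F ({..<n} \<rightarrow>\<^sub>E UNIV)"
    by (rule bij_betw_byWitness[where f' = "ps_flow n \<alpha>"]) (use 1 2 3 4 in blast)+
  show "bij_betw (ps_flow n \<alpha>) ({..<n} \<rightarrow>\<^sub>E UNIV) F"
    by (rule bij_betw_byWitness[where f' = "ps_coords n"]) (use 1 2 3 4 in blast)+
qed

section \<open>Lattice bases and independence of the coordinates\<close>

text \<open>For net flow 0 the map \<open>ps_flow\<close> is linear in the spoke values, so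
  combining the flows of the unit vectors with coefficients \<open>k\<close> gives the flow of
  \<open>k\<close>, and the bijection with the lattice applies.\<close>

lemma lattice_basis_pitman_stanley:
  "lattice_basis n (\<lambda>i. ps_flow n (\<lambda>_. 0) (\<lambda>k. of_bool (k = i))) (flow_lattice (pitman_stanley (n + 2)))"
proof -
  have "(\<lambda>e. \<Sum>i<n. k i * ps_flow n (\<lambda>_. 0) (\<lambda>l. of_bool (l = i)) e) = ps_flow n (\<lambda>_. 0) k"
    for k :: "nat \<Rightarrow> int"
  proof
    fix e :: "nat \<times> nat"
    obtain i j where e: "e = (i, j)" by fastforce
    have delta: "(\<Sum>i<n. k i * of_bool (l = i)) = k l" if "l < n" for l
      using that by (simp add: of_bool_def if_distrib cong: if_cong)
    consider (spoke) "i \<in> {1..n} \<and> j = n + 2"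
      | (path) "\<not> (i \<in> {1..n} \<and> j = n + 2)" "i \<in> {1..n + 1} \<and> j = Suc i"
      | (other) "\<not> (i \<in> {1..n} \<and> j = n + 2)" "\<not> (i \<in> {1..n + 1} \<and> j = Suc i)"
      by blast
    then show "(\<Sum>i<n. k i * ps_flow n (\<lambda>_. 0) (\<lambda>l. of_bool (l = i)) e) = ps_flow n (\<lambda>_. 0) k e"
    proof cases
      case spoke
      then show ?thesis
        unfolding e ps_flow_def prod.case if_P[OF spoke]
        using spoke by (intro delta) auto
    next
      case path
      have flow: "ps_flow n (\<lambda>_. 0) y (i, j) = - (\<Sum>l=1..min i n. y (l - 1))" for y :: "nat \<Rightarrow> int"
        unfolding ps_flow_def prod.case if_not_P[OF path(1)] if_P[OF path(2)] by simp
      have "(\<Sum>m<n. k m * (\<Sum>l=1..min i n. of_bool (l - 1 = m))) = (\<Sum>l=1..min i n. k (l - 1))"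
        unfolding sum_distrib_left by (subst sum.swap) (intro sum.cong delta, auto)
      then show ?thesis
        unfolding e flow mult_minus_right sum_negf by (rule arg_cong)
    next
      case other
      then show ?thesis
        unfolding e ps_flow_def prod.case if_not_P[OF other(1)] if_not_P[OF other(2)] by simp
    qed
  qed
  then show ?thesis
    using ps_flow_bij_betw(2)[where n = n and \<alpha> = "\<lambda>_. 0 :: int"]
    unfolding lattice_basis_def flow_lattice_def by simp
qed

lemma lattice_automorphism_int_matrix:
  fixes w :: "nat \<Rightarrow> nat \<Rightarrow> int"
  assumes bij: "bij_betw (\<lambda>k. \<lambda>i\<in>{..<n}. \<Sum>j<n. k j * w j i) ({..<n} \<rightarrow>\<^sub>E UNIV) ({..<n} \<rightarrow>\<^sub>E UNIV)"
  shows "lattice_automorphism {..<n} (\<lambda>t. \<lambda>i\<in>{..<n}. \<Sum>j<n. t j * of_int (w j i))"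
proof
  let ?g = "\<lambda>k. \<lambda>i\<in>{..<n}. \<Sum>j<n. k j * w j i"
  let ?T = "\<lambda>t. \<lambda>i\<in>{..<n}. \<Sum>j<n. t j * (of_int (w j i) :: real)"
  let ?E = "\<lambda>k. \<lambda>i\<in>{..<n}. (of_int (k i) :: real)"
  let ?Z = "{..<n} \<rightarrow>\<^sub>E (UNIV :: int set)"
  show "?T \<in> (\<Pi>\<^sub>M i\<in>{..<n}. lborel) \<rightarrow>\<^sub>M (\<Pi>\<^sub>M i\<in>{..<n}. lborel)"
    by (intro measurable_restrict) measurable
  show "?T (\<lambda>i\<in>{..<n}. x i + y i) = (\<lambda>i\<in>{..<n}. ?T x i + ?T y i)" for x y
    by (auto simp: fun_eq_iff sum.distrib algebra_simps)
  have E: "bij_betw ?E ?Z ({..<n} \<rightarrow>\<^sub>E \<int>)"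
  proof (rule bij_betw_byWitness[where f' = "\<lambda>x. \<lambda>i\<in>{..<n}. \<lfloor>x i\<rfloor>"])
    show "\<forall>k\<in>?Z. (\<lambda>i\<in>{..<n}. \<lfloor>?E k i\<rfloor>) = k"
    proof
      fix k assume "k \<in> ?Z"
      then have "restrict k {..<n} = k" by (rule PiE_restrict)
      moreover have "(\<lambda>i\<in>{..<n}. \<lfloor>?E k i\<rfloor>) = restrict k {..<n}"
        by (rule restrict_ext) simp
      ultimately show "(\<lambda>i\<in>{..<n}. \<lfloor>?E k i\<rfloor>) = k" by simp
    qed
    show "\<forall>x\<in>{..<n} \<rightarrow>\<^sub>E \<int>. ?E (\<lambda>i\<in>{..<n}. \<lfloor>x i\<rfloor>) = x"
    proof
      fix x :: "nat \<Rightarrow> real" assume x: "x \<in> {..<n} \<rightarrow>\<^sub>E \<int>"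
      then have "restrict x {..<n} = x" by (rule PiE_restrict)
      moreover have "?E (\<lambda>i\<in>{..<n}. \<lfloor>x i\<rfloor>) = restrict x {..<n}"
        using PiE_mem[OF x] by (intro restrict_ext) (auto elim!: Ints_cases)
      ultimately show "?E (\<lambda>i\<in>{..<n}. \<lfloor>x i\<rfloor>) = x" by simp
    qed
    show "?E ` ?Z \<subseteq> {..<n} \<rightarrow>\<^sub>E \<int>" "(\<lambda>x. \<lambda>i\<in>{..<n}. \<lfloor>x i\<rfloor>) ` ({..<n} \<rightarrow>\<^sub>E \<int>) \<subseteq> ?Z"
      by (intro image_subsetI restrict_PiE_iff[THEN iffD2]; simp)+
  qed
  \<comment> \<open>The integer bijection is transported along the embedding \<open>?E\<close> of
    integer vectors into real vectors, which intertwines \<open>?g\<close> and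
    \<open>?T\<close>.\<close>
  have "bij_betw (?E \<circ> ?g) ?Z ({..<n} \<rightarrow>\<^sub>E \<int>)"
    by (rule bij_betw_trans[OF bij E])
  also have "?E \<circ> ?g = ?T \<circ> ?E"
    by (auto simp: fun_eq_iff intro!: sum.cong)
  finally show "bij_betw ?T ({..<n} \<rightarrow>\<^sub>E \<int>) ({..<n} \<rightarrow>\<^sub>E \<int>)"
    unfolding bij_betw_comp_iff[OF E, symmetric] .
  fix y :: "nat \<Rightarrow> real" assume y: "y \<in> {..<n} \<rightarrow>\<^sub>E UNIV"
  \<comment> \<open>Real surjectivity comes from integer surjectivity: every unit vector has an
    integer preimage, and these preimages are combined with the real coefficients
    \<open>y l\<close>.\<close>
  have "\<exists>k. \<forall>i<n. (\<Sum>j<n. k j * w j i) = of_bool (i = l)" for l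
  proof -
    have "(\<lambda>i\<in>{..<n}. of_bool (i = l)) \<in> ?g ` ?Z"
      unfolding bij_betw_imp_surj_on[OF bij] by simp
    then obtain k where k: "(\<lambda>i\<in>{..<n}. of_bool (i = l)) = ?g k" by (rule imageE)
    have "(\<Sum>j<n. k j * w j i) = of_bool (i = l)" if "i < n" for i
      using fun_cong[OF k, of i] that by simp
    then show ?thesis by blast
  qed
  then obtain k where k: "\<And>l i. i < n \<Longrightarrow> (\<Sum>j<n. k l j * w j i) = of_bool (i = l)"
    using choice[of "\<lambda>l k. \<forall>i<n. (\<Sum>j<n. k j * w j i) = of_bool (i = l)"] by blast
  have right_inv: "?T (\<lambda>j\<in>{..<n}. \<Sum>l<n. y l * of_int (k l j)) i = y i" if "i < n" for i
  proof -
    have "?T (\<lambda>j\<in>{..<n}. \<Sum>l<n. y l * of_int (k l j)) i =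
        (\<Sum>j<n. \<Sum>l<n. y l * of_int (k l j * w j i))"
      using that by (simp add: sum_distrib_right mult.assoc)
    also have "\<dots> = (\<Sum>l<n. y l * of_int (\<Sum>j<n. k l j * w j i))"
      by (subst sum.swap) (simp add: sum_distrib_left)
    also have "\<dots> = y i"
      using that by (simp add: k of_bool_def if_distrib cong: if_cong)
    finally show ?thesis .
  qed
  have "?T (\<lambda>j\<in>{..<n}. \<Sum>l<n. y l * of_int (k l j)) = y"
  proof (intro ext)
    fix i
    show "?T (\<lambda>j\<in>{..<n}. \<Sum>l<n. y l * of_int (k l j)) i = y i"
      using right_inv[of i] PiE_arb[OF y, of i] by (cases "i < n") simp_all
  qed
  then show "\<exists>x\<in>{..<n} \<rightarrow>\<^sub>E UNIV. ?T x = y"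
    by (intro bexI[of _ "\<lambda>j\<in>{..<n}. \<Sum>l<n. y l * of_int (k l j)"]) auto
qed simp

text \<open>Nonnegativity on the spokes is \<open>y j\<close> being nonnegative, and on the first
  \<open>n\<close> path arcs it is the prefix bound. The last path arc carries the flow of its
  predecessor plus \<open>l ! n\<close>, so its condition follows from the others.\<close>

lemma flow_polytope_pitman_stanley_iff:
  assumes l: "length l = n + 1" and "1 \<le> n" and "0 \<le> l ! n"
    and b: "b \<in> flow_space (pitman_stanley (n + 2)) l"
  shows "b \<in> flow_polytope (pitman_stanley (n + 2)) l \<longleftrightarrow>
    ps_coords n b \<in> ps_region (\<lambda>i. of_int (l ! i)) n 0 (of_int (l ! 0))"
proof -
  let ?\<alpha> = "\<lambda>v. real_of_int (if v \<le> n + 1 then l ! (v - 1) else - sum_list l)"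
  have prefix: "(\<Sum>v=1..Suc j. ?\<alpha> v) = (\<Sum>i=0..j. of_int (l ! i))" if "j \<le> n" for j
  proof -
    have "(\<Sum>v=1..Suc j. ?\<alpha> v) = (\<Sum>i=0..j. ?\<alpha> (Suc i))"
      using sum.shift_bounds_cl_Suc_ivl[of ?\<alpha> 0 j] by simp
    also have "\<dots> = (\<Sum>i=0..j. of_int (l ! i))"
      using that by (intro sum.cong) auto
    finally show ?thesis .
  qed
  have total: "(\<Sum>v=1..n + 2. ?\<alpha> v) = 0"
    using prefix[of n] l by (simp add: sum_list_sum_nth atLeast0LessThan atLeast0AtMost lessThan_Suc_atMost)
  have path: "b (Suc j, Suc (Suc j)) = (\<Sum>i=0..j. of_int (l ! i)) - (\<Sum>i=1..min (Suc j) n. b (i, n + 2))"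
    if "j \<le> n" for j
  proof -
    have "\<forall>v\<in>{1..n + 2}. net_flow (pitman_stanley (n + 2)) b v = ?\<alpha> v"
      using b l unfolding flow_space_def verts_pitman_stanley by simp
    then have "b (Suc j, Suc (Suc j)) = (\<Sum>v=1..Suc j. ?\<alpha> v) - (\<Sum>i=1..min (Suc j) n. b (i, n + 2))"
      unfolding net_flow_pitman_stanley_eq_iff[OF total] using that by simp
    then show ?thesis unfolding prefix[OF that] .
  qed
  have spokes: "(\<Sum>i=1..min (Suc j) n. b (i, n + 2)) = (\<Sum>i=0..j. ps_coords n b i)" if "j < n" for j
  proof -
    have "(\<Sum>i=1..Suc j. b (i, n + 2)) = (\<Sum>i=0..j. b (Suc i, n + 2))"
      using sum.shift_bounds_cl_Suc_ivl[of "\<lambda>i. b (i, n + 2)" 0 j] by simp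
    then show ?thesis using that by (simp add: ps_coords_def min_def)
  qed
  have split0: "(\<Sum>i=0..j. of_int (l ! i)) = of_int (l ! 0) + (\<Sum>i\<in>{0<..j}. real_of_int (l ! i))" for j
    using sum.head[of 0 j "\<lambda>i. real_of_int (l ! i)"] by simp
  have inner: "0 \<le> b (Suc j, Suc (Suc j)) \<longleftrightarrow>
      (\<Sum>i=0..j. ps_coords n b i) \<le> of_int (l ! 0) + (\<Sum>i\<in>{0<..j}. real_of_int (l ! i))"
    if "j < n" for j
    using path[of j] spokes[of j] that by (simp add: split0)
  \<comment> \<open>No spoke starts at vertex \<open>n + 1\<close>, so the cuts at \<open>n\<close>
    and \<open>n + 1\<close> subtract the same spoke values.\<close>
  have last: "b (Suc n, Suc (Suc n)) = b (n, Suc n) + of_int (l ! n)"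
    using path[of n] path[of "n - 1"] \<open>1 \<le> n\<close> by (cases n) simp_all
  have "b \<in> flow_polytope (pitman_stanley (n + 2)) l \<longleftrightarrow>
      (\<forall>i\<in>{1..n + 1}. 0 \<le> b (i, Suc i)) \<and> (\<forall>i\<in>{1..n}. 0 \<le> b (i, n + 2))"
    using b unfolding flow_polytope_def arcs_pitman_stanley by auto
  also have "(\<forall>i\<in>{1..n + 1}. 0 \<le> b (i, Suc i)) \<longleftrightarrow> (\<forall>j<n. 0 \<le> b (Suc j, Suc (Suc j)))"
  proof (intro iffI ballI allI impI)
    fix i assume *: "\<forall>j<n. 0 \<le> b (Suc j, Suc (Suc j))" and "i \<in> {1..n + 1}"
    then consider j where "i = Suc j" "j < n" | "i = Suc n" by (cases i) fastforce+
    then show "0 \<le> b (i, Suc i)"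
    proof cases
      case 2
      have "0 \<le> b (n, Suc n)" using *[rule_format, of "n - 1"] \<open>1 \<le> n\<close> by simp
      then show ?thesis using 2 last assms(3) by simp
    qed (use * in simp)
  qed simp
  also have "(\<forall>i\<in>{1..n}. 0 \<le> b (i, n + 2)) \<longleftrightarrow> (\<forall>j<n. 0 \<le> ps_coords n b j)"
  proof (intro iffI ballI allI impI)
    fix i assume *: "\<forall>j<n. 0 \<le> ps_coords n b j" and "i \<in> {1..n}"
    then obtain j where "i = Suc j" "j < n" by (cases i) auto
    then show "0 \<le> b (i, n + 2)" using *[rule_format, of j] by (simp add: ps_coords_def)
  qed (simp add: ps_coords_def)
  finally show ?thesis
    unfolding ps_region_def using inner by (auto simp: ps_coords_def atLeast0LessThan)
qed

text \<open>In spoke coordinates the parametrization by \<open>p\<close> and \<open>u\<close> is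
  \<open>?T\<close> followed by a translation, where \<open>?T\<close> is the matrix of
  \<open>u\<close>. Both preserve measure, so the value is the same for all \<open>p\<close> and
  \<open>u\<close>.\<close>

lemma coordinate_volume_pitman_stanley:
  assumes l: "length l = n + 1" and "1 \<le> n" and "0 \<le> l ! n"
    and u: "lattice_basis n u (flow_lattice (pitman_stanley (n + 2)))"
    and p: "p \<in> flow_space (pitman_stanley (n + 2)) l"
  shows "coordinate_volume n p u (flow_polytope (pitman_stanley (n + 2)) l) =
    measure (\<Pi>\<^sub>M i\<in>{0..<n}. lborel) (ps_region (\<lambda>i. of_int (l ! i)) n 0 (of_int (l ! 0)))"
proof -
  let ?G = "pitman_stanley (n + 2)"
  let ?I = "{..<n}"
  let ?M = "\<Pi>\<^sub>M i\<in>?I. (lborel :: real measure)"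
  let ?T = "\<lambda>t. \<lambda>i\<in>?I. \<Sum>j<n. t j * real_of_int (u j (Suc i, n + 2))"
  let ?R = "ps_region (\<lambda>i. of_int (l ! i)) n 0 (of_int (l ! 0))"
  let ?S = "{x \<in> ?I \<rightarrow>\<^sub>E UNIV. (\<lambda>i\<in>?I. p (Suc i, n + 2) + x i) \<in> ?R}"
  have R: "?R \<in> sets ?M"
    using ps_region_sets[of _ n 0] by (simp add: atLeast0LessThan)
  have "bij_betw (ps_coords n) (flow_lattice ?G) (?I \<rightarrow>\<^sub>E UNIV)"
    using ps_flow_bij_betw(1)[where n = n and \<alpha> = "\<lambda>_. 0 :: int"] unfolding flow_lattice_def by simp
  \<comment> \<open>Integer coefficients correspond to lattice vectors through \<open>u\<close>, and
    lattice vectors to integer spoke values; the composite is the matrix of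
    \<open>?T\<close>.\<close>
  from bij_betw_trans[OF u[unfolded lattice_basis_def] this]
  interpret lattice_automorphism ?I ?T
    by (intro lattice_automorphism_int_matrix) (simp add: ps_coords_def o_def)
  have u_lattice: "u j \<in> flow_lattice ?G" if "j < n" for j
  proof -
    have "(\<lambda>e. \<Sum>i<n. (\<lambda>i\<in>?I. of_bool (i = j)) i * u i e) \<in> flow_lattice ?G"
      by (rule bij_betwE[OF u[unfolded lattice_basis_def], rule_format]) (rule restrict_PiE_iff[THEN iffD2], simp)
    also have "(\<lambda>e. \<Sum>i<n. (\<lambda>i\<in>?I. of_bool (i = j)) i * u i e) = u j"
      using that by (simp add: of_bool_def if_distrib if_distribR cong: if_cong)
    finally show ?thesis .
  qed
  have flow: "(\<lambda>e. p e + (\<Sum>i<n. t i * of_int (u i e))) \<in> flow_space ?G l" for t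
  proof -
    have "net_flow ?G (\<lambda>e. p e + (\<Sum>i<n. t i * of_int (u i e))) v =
        net_flow ?G p v + (\<Sum>i<n. t i * of_int (net_flow ?G (u i) v))" for v
    proof -
      have "(\<Sum>e\<in>arcs ?G. (\<Sum>i<n. t i * of_int (u i e)) * (of_bool (v = tail ?G e) - of_bool (v = head ?G e))) =
        (\<Sum>i<n. t i * of_int (net_flow ?G (u i) v))"
        unfolding net_flow_def sum_distrib_right of_int_sum sum_distrib_left
        by (subst sum.swap) (simp add: mult.assoc)
      then show ?thesis
        by (simp add: net_flow_def distrib_right sum.distrib)
    qed
    then show ?thesis
      using p u_lattice by (simp add: flow_space_def flow_lattice_def)
  qed
  have "ps_coords n (\<lambda>e. p e + (\<Sum>i<n. t i * of_int (u i e))) = (\<lambda>i\<in>?I. p (Suc i, n + 2) + ?T t i)" for t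
    by (auto simp: ps_coords_def)
  then have "{t \<in> ?I \<rightarrow>\<^sub>E UNIV. (\<lambda>e. p e + (\<Sum>i<n. t i * of_int (u i e))) \<in> flow_polytope ?G l} =
      {t \<in> ?I \<rightarrow>\<^sub>E UNIV. ?T t \<in> ?S}"
    using flow_polytope_pitman_stanley_iff[OF l assms(2,3) flow] by auto
  moreover have "?S \<in> sets ?M"
  proof -
    have "(\<lambda>x. \<lambda>i\<in>?I. p (Suc i, n + 2) + x i) \<in> ?M \<rightarrow>\<^sub>M ?M" by measurable
    from measurable_sets[OF this R] show ?thesis
      by (simp add: vimage_def space_PiM Int_def conj_commute)
  qed
  ultimately show ?thesis
    using emeasure_vimage[of ?S] emeasure_PiM_lborel_translate[OF _ R, of "\<lambda>i. p (Suc i, n + 2)"]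
    by (simp add: coordinate_volume_def measure_def atLeast0LessThan)
qed

theorem proposition5p4:
  fixes n :: nat and a b c :: int
  assumes "1 \<le> n" and "0 < a" and "0 < b" and "0 < c"
  shows "normalized_volume (pitman_stanley (n + 2)) ([a, b] @ replicate (n - 1) c) =
    of_int ((a + b - c) * (a + b + (int n - 1) * c) ^ (n - 1)
            - (b - c) * (b + (int n - 1) * c) ^ (n - 1))"
proof -
  define l where "l = [a, b] @ replicate (n - 1) c"
  let ?G = "pitman_stanley (n + 2)"
  have len: "length l = n + 1" using assms by (simp add: l_def)
  have nth: "l ! i = (if i = 0 then a else if i = 1 then b else c)" if "i \<le> n" for i
    using that by (auto simp: l_def nth_Cons nth_append split: nat.splits)
  \<comment> \<open>The choice of a base point by \<open>SOME\<close> is meaningful only if the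
    affine space is inhabited. The entries of the net flow vector sum to 0, so
    \<open>ps_flow\<close> of any spoke values is a point of it.\<close>
  have "\<exists>p. p \<in> flow_space ?G l"
  proof -
    let ?\<alpha> = "\<lambda>v. real_of_int (if v \<le> length l then l ! (v - 1) else - sum_list l)"
    have "(\<Sum>v=1..n + 2. ?\<alpha> v) = (\<Sum>i=0..n. ?\<alpha> (Suc i)) - of_int (sum_list l)"
      using sum.shift_bounds_cl_Suc_ivl[of ?\<alpha> 0 n] len by simp
    also have "\<dots> = 0"
      using len by (simp add: sum_list_sum_nth atLeast0LessThan atLeast0AtMost lessThan_Suc_atMost)
    finally have "(\<Sum>v=1..n + 2. ?\<alpha> v) = 0" .
    from bij_betwE[OF ps_flow_bij_betw(2)[OF this]] show ?thesis
      unfolding flow_space_def by (meson PiE_eq_empty_iff UNIV_not_empty all_not_in_conv)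
  qed
  then have p: "(SOME p. p \<in> flow_space ?G l) \<in> flow_space ?G l"
    by (rule someI_ex)
  have u: "lattice_basis n (SOME u. lattice_basis n u (flow_lattice ?G)) (flow_lattice ?G)"
    by (rule someI[of "\<lambda>u. lattice_basis n u (flow_lattice ?G)", OF lattice_basis_pitman_stanley])
  have "lattice_volume n (flow_lattice ?G) (flow_space ?G l) (flow_polytope ?G l) =
      measure (\<Pi>\<^sub>M i\<in>{0..<n}. lborel) (ps_region (\<lambda>i. of_int (l ! i)) n 0 (of_int (l ! 0)))"
    unfolding lattice_volume_def
    using assms nth by (intro coordinate_volume_pitman_stanley len p u) auto
  also have "ps_region (\<lambda>i. of_int (l ! i)) n 0 (of_int (l ! 0)) =
      ps_region (\<lambda>i. if i = 1 then of_int b else of_int c) n 0 (of_int a)"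
  proof -
    have "(\<Sum>i\<in>{0<..j}. real_of_int (l ! i)) = (\<Sum>i\<in>{0<..j}. if i = 1 then of_int b else of_int c)"
      if "j < n" for j
      using that by (intro sum.cong) (auto simp: nth)
    then show ?thesis by (auto simp: ps_region_def nth)
  qed
  finally have "fact n * lattice_volume n (flow_lattice ?G) (flow_space ?G l) (flow_polytope ?G l) =
    of_int ((a + b - c) * (a + b + (int n - 1) * c) ^ (n - 1)
            - (b - c) * (b + (int n - 1) * c) ^ (n - 1))"
    using measure_ps_region[of "of_int a" "of_int b" "of_int c" n] assms by simp
  \<comment> \<open>The dimension M - N is (2 n + 1) - (n + 1) = n, so the normalizing factorial
    cancels the one in the volume of the region.\<close>
  moreover have "card (arcs ?G) - length l = n"
    unfolding card_arcs_pitman_stanley len by simp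
  ultimately show ?thesis
    unfolding normalized_volume_def l_def[symmetric] by (simp add: Let_def)
qed

end
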